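(* Let $f\in T_{\mathbb{S}(I)}(X,\mathcal{P})$. Then $f\in E\big(T_{\mathbb{S}(I)}(X,\mathcal{P})\big)$ if and only if: (i) $\chi^{(f)}\in E(\mathbb{S}(I))$; (ii) $f_{\upharpoonright X_i}\in E(T(X_i))$ for all $i\in I\chi^{(f)}$; and (iii) $X_if\subseteq X_{i\chi^{(f)}}f$ for all $i\in I\setminus I\chi^{(f)}$.
   Context: $X$ is a nonempty set (possibly infinite) and $\mathcal{P}=\{X_i : i\in I\}$ is a partition of $X$ into nonempty blocks, with $X_i\cap X_j=\varnothing$ for $i\neq j$. $T(Z)$ denotes the semigroup of all maps $Z\to Z$ under composition. Maps are written on the right and composed from left to right: $x(fg)=(xf)g$; $Af=\{af: a\in A\}$. $T(X,\mathcal{P})$ is the subsemigroup of all $f\in T(X)$ such that for every $i\in I$ there is $j\in I$ with $X_if\subseteq X_j$. For $f\in T(X,\mathcal{P})$ the character $\chi^{(f)}\in T(I)$ is defined by $i\chi^{(f)}=j$ whenever $X_if\subseteq X_j$. $\mathbb{S}(I)$ is an arbitrary subsemigroup of $T(I)$, and $T_{\mathbb{S}(I)}(X,\mathcal{P})=\{f\in T(X,\mathcal{P}): \chi^{(f)}\in \mathbb{S}(I)\}$, a subsemigroup of $T(X,\mathcal{P})$. For a semigroup $S$, $E(S)=\{a\in S: a^2=a\}$ is its set of idempotents. $f_{\upharpoonright X_i}$ is the restriction of $f$ to $X_i$; the assertion $f_{\upharpoonright X_i}\in E(T(X_i))$ means that $X_if\subseteq X_i$ and that the restriction, viewed as a map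 $X_i\to X_i$, is idempotent. *)

theory Defs
  imports "HOL-Library.FuncSet" "HOL-Library.Disjoint_Sets"
begin

text \<open>
  Self-maps of a set \<open>Z\<close> are represented extensionally (value \<open>undefined\<close> outside \<open>Z\<close>), so that
  equality of elements of \<open>T(Z)\<close> is equality of HOL functions.
\<close>

definition full_transformations :: "'a set \<Rightarrow> ('a \<Rightarrow> 'a) set" where
  "full_transformations Z = Z \<rightarrow>\<^sub>E Z"

text \<open>Maps act on the right: the product \<open>fg\<close> applies \<open>f\<close> first, \<open>x(fg) = (xf)g\<close>.\<close>

definition trans_mult :: "'a set \<Rightarrow> ('a \<Rightarrow> 'a) \<Rightarrow> ('a \<Rightarrow> 'a) \<Rightarrow> ('a \<Rightarrow> 'a)" where
  "trans_mult Z f g = compose Z g f"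

definition subsemigroup :: "('s \<Rightarrow> 's \<Rightarrow> 's) \<Rightarrow> 's set \<Rightarrow> 's set \<Rightarrow> bool" where
  "subsemigroup m S T \<longleftrightarrow> S \<noteq> {} \<and> S \<subseteq> T \<and> (\<forall>a\<in>S. \<forall>b\<in>S. m a b \<in> S)"

definition idempotents :: "('s \<Rightarrow> 's \<Rightarrow> 's) \<Rightarrow> 's set \<Rightarrow> 's set" where
  "idempotents m S = {a \<in> S. m a a = a}"

definition indexed_partition :: "'a set \<Rightarrow> 'i set \<Rightarrow> ('i \<Rightarrow> 'a set) \<Rightarrow> bool" where
  "indexed_partition X I P \<longleftrightarrow>
     (\<Union>i\<in>I. P i) = X \<and> disjoint_family_on P I \<and> (\<forall>i\<in>I. P i \<noteq> {})"

definition partition_transformations ::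
    "'a set \<Rightarrow> 'i set \<Rightarrow> ('i \<Rightarrow> 'a set) \<Rightarrow> ('a \<Rightarrow> 'a) set" where
  "partition_transformations X I P =
     {f \<in> full_transformations X. \<forall>i\<in>I. \<exists>j\<in>I. f ` P i \<subseteq> P j}"

text \<open>
  The index \<open>j\<close> is unique because the blocks are nonempty and pairwise disjoint;
  see \<open>character_eqI\<close> below.
\<close>

definition character :: "'i set \<Rightarrow> ('i \<Rightarrow> 'a set) \<Rightarrow> ('a \<Rightarrow> 'a) \<Rightarrow> ('i \<Rightarrow> 'i)" where
  "character I P f = (\<lambda>i\<in>I. THE j. j \<in> I \<and> f ` P i \<subseteq> P j)"

definition char_transformations ::
    "'a set \<Rightarrow> 'i set \<Rightarrow> ('i \<Rightarrow> 'a set) \<Rightarrow> ('i \<Rightarrow> 'i) set \<Rightarrow> ('a \<Rightarrow> 'a) set" where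
  "char_transformations X I P S =
     {f \<in> partition_transformations X I P. character I P f \<in> S}"

lemma character_eqI:
  assumes part: "indexed_partition X I P" and "i \<in> I" "j \<in> I" and fij: "f ` P i \<subseteq> P j"
  shows "character I P f i = j"
proof -
  have "P i \<noteq> {}"
    using part \<open>i \<in> I\<close> by (simp add: indexed_partition_def)
  then obtain x where x: "x \<in> P i" by (meson ex_in_conv)
  have uniq: "k = j" if "k \<in> I" "f ` P i \<subseteq> P k" for k
  proof (rule ccontr)
    assume "k \<noteq> j"
    then have "P k \<inter> P j = {}"
      using part \<open>k \<in> I\<close> \<open>j \<in> I\<close> by (simp add: indexed_partition_def disjoint_family_on_def)
    moreover have "f x \<in> P k" using x that(2) by (meson image_subset_iff)
    moreover have "f x \<in> P j" using x fij by (meson image_subset_iff)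
    ultimately show False by (meson disjoint_iff)
  qed
  have "(THE j. j \<in> I \<and> f ` P i \<subseteq> P j) = j"
  proof (rule the_equality)
    show "j \<in> I \<and> f ` P i \<subseteq> P j" using \<open>j \<in> I\<close> fij by (rule conjI)
  qed (metis uniq)
  then show ?thesis using \<open>i \<in> I\<close> by (simp add: character_def)
qed

end

theory Submission
  imports Defs
begin

text \<open>
  Idempotency of a self-map means that it fixes every point of its image. Write \<open>\<chi>\<close> for the
  character of \<open>f\<close>, so that \<open>f\<close> sends the block \<open>P i\<close> into \<open>P (\<chi> i)\<close>.

  If \<open>f\<close> fixes its image, then a point \<open>f x\<close> with \<open>x \<in> P i\<close> lies in \<open>P (\<chi> i)\<close>, and being equal to
  \<open>f (f x)\<close> it also lies in \<open>P (\<chi> (\<chi> i))\<close>; disjointness of the blocks makes \<open>\<chi>\<close> idempotent. So \<open>\<chi>\<close>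
  fixes each index in its image, which means that \<open>f\<close> maps the corresponding block to itself and
  acts on it idempotently. Moreover \<open>f x = f (f x)\<close> exhibits \<open>f x\<close> as the image of a point of
  \<open>P (\<chi> i)\<close>.

  Conversely, on a block whose index is in the image of \<open>\<chi>\<close> the identity \<open>f (f x) = f x\<close> is condition
  (ii). On any other block, condition (iii) replaces \<open>x\<close> by a point \<open>y\<close> of a block of the first kind
  with the same value \<open>f y = f x\<close>, and the identity for \<open>y\<close> gives the identity for \<open>x\<close>.
\<close>

lemma trans_mult_self_eq_iff:
  assumes "g \<in> full_transformations Z"
  shows "trans_mult Z g g = g \<longleftrightarrow> (\<forall>x\<in>Z. g (g x) = g x)"
proof -
  have g: "g \<in> extensional Z"
    using assms by (simp add: full_transformations_def PiE_def)
  show ?thesis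
  proof
    assume "trans_mult Z g g = g"
    then show "\<forall>x\<in>Z. g (g x) = g x"
      unfolding trans_mult_def by (metis compose_eq)
  next
    assume "\<forall>x\<in>Z. g (g x) = g x"
    then show "trans_mult Z g g = g"
      unfolding trans_mult_def
      by (intro extensionalityI[OF compose_extensional g]) (simp add: compose_eq)
  qed
qed

text \<open>
  The inclusion \<open>f ` A \<subseteq> A\<close> expresses that the restriction is a self-map of \<open>A\<close> at all. It also ensures
  that the square of the restriction agrees on \<open>A\<close> with the square of \<open>f\<close>, so that the restriction
  can be dropped from the idempotency condition.
\<close>

lemma restrict_idempotent_iff:
  "restrict f A \<in> idempotents (trans_mult A) (full_transformations A) \<longleftrightarrow>
     f ` A \<subseteq> A \<and> (\<forall>x\<in>A. f (f x) = f x)"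
proof -
  have mem: "restrict f A \<in> full_transformations A \<longleftrightarrow> f ` A \<subseteq> A"
    by (auto simp: full_transformations_def PiE_def Pi_def)
  show ?thesis
  proof (cases "f ` A \<subseteq> A")
    case True
    then have "restrict f A (restrict f A x) = restrict f A x \<longleftrightarrow> f (f x) = f x" if "x \<in> A" for x
      using that by auto
    then show ?thesis
      using True mem trans_mult_self_eq_iff[of "restrict f A" A]
      by (simp add: idempotents_def del: restrict_apply)
  next
    case False
    then show ?thesis using mem by (simp add: idempotents_def)
  qed
qed

lemma character_maps_block:
  assumes "indexed_partition X I P" and "f \<in> partition_transformations X I P" and "i \<in> I"
  shows "character I P f i \<in> I" and "f ` P i \<subseteq> P (character I P f i)"
proof -
  obtain j where j: "j \<in> I" "f ` P i \<subseteq> P j"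
    using assms(2,3) by (auto simp: partition_transformations_def)
  have "character I P f i = j"
    using character_eqI[OF assms(1,3) j] .
  with j show "character I P f i \<in> I" "f ` P i \<subseteq> P (character I P f i)"
    by simp_all
qed

theorem proposition3p9:
  fixes X :: "'a set" and I :: "'i set" and P :: "'i \<Rightarrow> 'a set"
    and S :: "('i \<Rightarrow> 'i) set" and f :: "'a \<Rightarrow> 'a"
  assumes "X \<noteq> {}"
    and "indexed_partition X I P"
    and "subsemigroup (trans_mult I) S (full_transformations I)"
    and "f \<in> char_transformations X I P S"
  shows "f \<in> idempotents (trans_mult X) (char_transformations X I P S) \<longleftrightarrow>
      character I P f \<in> idempotents (trans_mult I) S
    \<and> (\<forall>i \<in> character I P f ` I.
          restrict f (P i) \<in> idempotents (trans_mult (P i)) (full_transformations (P i)))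
    \<and> (\<forall>i \<in> I - character I P f ` I. f ` P i \<subseteq> f ` P (character I P f i))"
proof -
  define \<chi> where "\<chi> = character I P f"
  have X: "X = (\<Union>i\<in>I. P i)"
    using assms(2) by (simp add: indexed_partition_def)
  have f: "f \<in> partition_transformations X I P" and \<chi>S: "\<chi> \<in> S"
    using assms(4) by (simp_all add: char_transformations_def \<chi>_def)
  have fX: "f \<in> full_transformations X"
    using f by (simp add: partition_transformations_def)
  have \<chi>T: "\<chi> \<in> full_transformations I"
    by (rule subsetD[OF _ \<chi>S]) (use assms(3) in \<open>simp add: subsemigroup_def\<close>)
  have \<chi>_in: "\<chi> i \<in> I" and f_in: "f ` P i \<subseteq> P (\<chi> i)" if "i \<in> I" for i
    using character_maps_block[OF assms(2) f that] by (simp_all add: \<chi>_def)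
  have idem_f: "f \<in> idempotents (trans_mult X) (char_transformations X I P S) \<longleftrightarrow>
      (\<forall>i\<in>I. \<forall>x\<in>P i. f (f x) = f x)"
    using assms(4) trans_mult_self_eq_iff[OF fX] by (simp add: idempotents_def X)
  have idem_\<chi>: "\<chi> \<in> idempotents (trans_mult I) S \<longleftrightarrow> (\<forall>i\<in>I. \<chi> (\<chi> i) = \<chi> i)"
    using \<chi>S trans_mult_self_eq_iff[OF \<chi>T] by (simp add: idempotents_def)
  have "(\<forall>i\<in>I. \<forall>x\<in>P i. f (f x) = f x) \<longleftrightarrow>
      (\<forall>i\<in>I. \<chi> (\<chi> i) = \<chi> i)
    \<and> (\<forall>i\<in>\<chi> ` I. f ` P i \<subseteq> P i \<and> (\<forall>x\<in>P i. f (f x) = f x))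
    \<and> (\<forall>i\<in>I - \<chi> ` I. f ` P i \<subseteq> f ` P (\<chi> i))"
    (is "?idem \<longleftrightarrow> ?i \<and> ?ii \<and> ?iii")
  proof
    assume idem: ?idem
    have \<chi>_idem: "\<chi> (\<chi> i) = \<chi> i" if i: "i \<in> I" for i
    proof -
      have "f x \<in> P (\<chi> (\<chi> i))" if x: "x \<in> P i" for x
      proof -
        have "f x \<in> P (\<chi> i)" using f_in[OF i] x by blast
        then have "f (f x) \<in> P (\<chi> (\<chi> i))" using f_in[OF \<chi>_in[OF i]] by blast
        then show ?thesis using idem i x by simp
      qed
      then have "f ` P i \<subseteq> P (\<chi> (\<chi> i))" by blast
      then have "character I P f i = \<chi> (\<chi> i)"
        by (rule character_eqI[OF assms(2) i \<chi>_in[OF \<chi>_in[OF i]]])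
      then show ?thesis by (simp add: \<chi>_def)
    qed
    have ?ii
    proof
      fix i assume "i \<in> \<chi> ` I"
      then obtain j where "j \<in> I" "i = \<chi> j" by blast
      then have "i \<in> I" "\<chi> i = i" by (simp_all add: \<chi>_in \<chi>_idem)
      then show "f ` P i \<subseteq> P i \<and> (\<forall>x\<in>P i. f (f x) = f x)"
        using f_in[of i] idem by simp
    qed
    moreover have ?iii
    proof (intro ballI subsetI)
      fix i y assume i: "i \<in> I - \<chi> ` I" and "y \<in> f ` P i"
      then obtain x where x: "x \<in> P i" "y = f x" by blast
      have "y = f (f x)" using idem i x by (metis DiffD1)
      moreover have "f x \<in> P (\<chi> i)" using f_in[of i] i x(1) by blast
      ultimately show "y \<in> f ` P (\<chi> i)" by blast
    qed
    moreover have ?i using \<chi>_idem by (rule ballI)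
    ultimately show "?i \<and> ?ii \<and> ?iii" by (intro conjI)
  next
    assume conds: "?i \<and> ?ii \<and> ?iii"
    have ii: "f (f x) = f x" if "i \<in> \<chi> ` I" "x \<in> P i" for i x
      using conds[THEN conjunct2, THEN conjunct1, THEN bspec, OF that(1)] that(2) by simp
    have iii: "f ` P i \<subseteq> f ` P (\<chi> i)" if "i \<in> I - \<chi> ` I" for i
      using conds[THEN conjunct2, THEN conjunct2] that by (rule bspec)
    show ?idem
    proof (intro ballI)
      fix i x assume i: "i \<in> I" and x: "x \<in> P i"
      show "f (f x) = f x"
      proof (cases "i \<in> \<chi> ` I")
        case True
        then show ?thesis using x by (rule ii)
      next
        case False
        with i have "f ` P i \<subseteq> f ` P (\<chi> i)" by (intro iii DiffI)
        with x obtain y where y: "y \<in> P (\<chi> i)" "f x = f y" by blast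
        have "f (f y) = f y" using imageI[OF i] y(1) by (rule ii)
        then show ?thesis using y(2) by simp
      qed
    qed
  qed
  then show ?thesis
    unfolding idem_f restrict_idempotent_iff \<chi>_def[symmetric] idem_\<chi> .
qed

end
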